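(* Let $k=(k_1,k_2)\in2\mathbb{Z}\times\mathbb{Z}$ with $k_1\ge1$ and $k_2\ge1$. Then the value of $E(\lambda,k)$ at $e=1\in S^1$ is $$E(\lambda,k;e)=\frac{\widetilde{c}_{w_0}(\rho(k)\epsilon,k)}{\widetilde{c}_{w^\lambda w_{\lambda^*}}(\lambda^*+\rho(k)\epsilon,k)},\qquad\lambda\in P=\mathbb{Z}\epsilon,$$ where $w_0=s$ is the longest element of the Weyl group $\mathbb{Z}_2=\{1,s\}$.
   Context: Let $\rho(k)=\frac12(k_1+2k_2)$. On $\mathbb{C}[z^{\pm1}]$ consider the inner product $(f,g)_k=\int_{S^1}\overline{f(z)}g(z)\delta_k(z)\frac{dz}{iz}$, $\delta_k(z)=(1-(z+z^{-1})/2)^{k_1}(1-(z^2+z^{-2})/2)^{k_2}$. The non-symmetric Jacobi polynomials $E(n\epsilon,k)=E(n,k)=z^n+$ (combination of earlier monomials), $n\in\mathbb{Z}$, are obtained by Gram–Schmidt from the ordered basis $(1,z,z^{-1},z^2,z^{-2},\dots)$; $E(\lambda,k;z)$ denotes the value at $z\in S^1$. $P=\mathbb{Z}\epsilon$, and $s\epsilon=-\epsilon$. For $\lambda=n\epsilon$: $\lambda^*=|n|\epsilon$; $w^\lambda=1$ if $n\ge0$, $w^\lambda=s$ if $n<0$; $w_\lambda=s$ if $n=0$, $w_\lambda=1$ if $n\neq0$. Thus $w^\lambda w_{\lambda^*}=1$ for $n>0$ and $=s$ for $n\le0$. For $\lambda=t\epsilon$ ($t\in\mathbb{R}$) the generalized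 Harish-Chandra $c$-functions are $$\widetilde{c}_1(\lambda,k)=\frac{\Gamma(t)\Gamma(t+\frac12)}{2^{k_1}\Gamma(t+\frac12k_1+\frac12)\Gamma(t+\frac12k_1+k_2)},\quad\widetilde{c}_s(\lambda,k)=\frac{\Gamma(t+\frac12)\Gamma(t+1)}{2^{k_1}\Gamma(t+\frac12k_1+\frac12)\Gamma(t+\frac12k_1+k_2+1)}.$$ *)

theory Defs
  imports "HOL-Complex_Analysis.Complex_Analysis"
begin

text \<open>
  The lattice \<open>P = \<int>\<epsilon>\<close> is identified with \<^typ>\<open>int\<close> (the weight \<open>n\<epsilon>\<close> is \<open>n\<close>), and a point \<open>t\<epsilon>\<close>
  of its real span with the real number \<open>t\<close>.  A multiplicity parameter \<open>k = (k\<^sub>1, k\<^sub>2)\<close> is a pair of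
  integers.  Laurent polynomials are represented by the functions on the complex plane that they
  define; only their values on the unit circle matter.
\<close>

definition rho :: "int \<times> int \<Rightarrow> real" where
  "rho k = (1 / 2) * (of_int (fst k) + 2 * of_int (snd k))"

definition jacobi_weight :: "int \<times> int \<Rightarrow> complex \<Rightarrow> complex" where
  "jacobi_weight k z =
     (1 - (z + inverse z) / 2) powi (fst k) * (1 - (z powi 2 + z powi (-2)) / 2) powi (snd k)"

definition jacobi_inner ::
  "int \<times> int \<Rightarrow> (complex \<Rightarrow> complex) \<Rightarrow> (complex \<Rightarrow> complex) \<Rightarrow> complex" where
  "jacobi_inner k f g =
     contour_integral (circlepath 0 1) (\<lambda>z. cnj (f z) * g z * jacobi_weight k z / (\<i> * z))"

text \<open>
  The exponents in the ordered basis \<open>1, z, z\<^sup>-\<^sup>1, z\<^sup>2, z\<^sup>-\<^sup>2, \<dots>\<close>, numbered from \<open>0\<close>, and the position of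
  a given exponent in that list.
\<close>

definition basis_exponent :: "nat \<Rightarrow> int" where
  "basis_exponent j = (if odd j then int ((j + 1) div 2) else - int (j div 2))"

definition basis_position :: "int \<Rightarrow> nat" where
  "basis_position n = (if n > 0 then nat (2 * n - 1) else nat (- 2 * n))"

lemma basis_exponent_position: "basis_exponent (basis_position n) = n"
proof (cases "n > 0")
  case True
  then obtain m where "n = int (Suc m)"
    using gr0_implies_Suc zero_less_imp_eq_int by blast
  then show ?thesis
    by (simp add: basis_exponent_def basis_position_def nat_add_distrib nat_mult_distrib)
next
  case False
  then obtain m where "n = - int m"
    by (metis int_cases2 of_nat_0_less_iff of_nat_0 neq0_conv minus_zero)
  then show ?thesis
    by (simp add: basis_exponent_def basis_position_def nat_mult_distrib)
qed

lemma basis_position_exponent: "basis_position (basis_exponent j) = j"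
  by (auto simp: basis_exponent_def basis_position_def elim!: oddE evenE)

text \<open>
  Gram--Schmidt without normalisation of the vectors, so that the result stays monic in the
  monomial it starts from.
\<close>

fun jacobi_gram_schmidt :: "int \<times> int \<Rightarrow> nat \<Rightarrow> complex \<Rightarrow> complex" where
  "jacobi_gram_schmidt k j =
     (\<lambda>z. z powi basis_exponent j -
        (\<Sum>i<j. jacobi_inner k (jacobi_gram_schmidt k i) (\<lambda>w. w powi basis_exponent j)
              / jacobi_inner k (jacobi_gram_schmidt k i) (jacobi_gram_schmidt k i)
              * jacobi_gram_schmidt k i z))"

declare jacobi_gram_schmidt.simps [simp del]

definition nonsym_jacobi :: "int \<Rightarrow> int \<times> int \<Rightarrow> complex \<Rightarrow> complex" where
  "nonsym_jacobi n k = jacobi_gram_schmidt k (basis_position n)"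

text \<open>
  The Weyl group \<open>\<int>\<^sub>2 = {1, s}\<close>, written multiplicatively.
\<close>

datatype weyl = WId | WRefl

instantiation weyl :: comm_monoid_mult
begin

definition one_weyl :: weyl where
  "one_weyl = WId"

definition times_weyl :: "weyl \<Rightarrow> weyl \<Rightarrow> weyl" where
  "times_weyl v w = (if v = w then WId else WRefl)"

instance
proof
  fix a b c :: weyl
  show "a * b * c = a * (b * c)"
    by (cases a; cases b; cases c) (simp_all add: times_weyl_def)
  show "a * b = b * a"
    by (simp add: times_weyl_def eq_commute)
  show "1 * a = a"
    by (cases a) (simp_all add: times_weyl_def one_weyl_def)
qed

end

abbreviation longest_weyl :: weyl where
  "longest_weyl \<equiv> WRefl"

text \<open>
  In the order of the definitions: \<open>\<lambda>\<^sup>*\<close>, \<open>w\<^sup>\<lambda>\<close> and \<open>w\<^sub>\<lambda>\<close>.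
\<close>

definition weight_star :: "int \<Rightarrow> int" where
  "weight_star n = \<bar>n\<bar>"

definition w_upper :: "int \<Rightarrow> weyl" where
  "w_upper n = (if n \<ge> 0 then 1 else WRefl)"

definition w_lower :: "int \<Rightarrow> weyl" where
  "w_lower n = (if n = 0 then WRefl else 1)"

definition c_tilde :: "weyl \<Rightarrow> real \<Rightarrow> int \<times> int \<Rightarrow> real" where
  "c_tilde w t k = (let k1 = of_int (fst k); k2 = of_int (snd k) in
     case w of
       WId \<Rightarrow> Gamma t * Gamma (t + 1/2) /
                (2 powi (fst k) * Gamma (t + k1 / 2 + 1/2) * Gamma (t + k1 / 2 + k2))
     | WRefl \<Rightarrow> Gamma (t + 1/2) * Gamma (t + 1) /
                (2 powi (fst k) * Gamma (t + k1 / 2 + 1/2) * Gamma (t + k1 / 2 + k2 + 1)))"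

end

theory Submission
  imports Defs
begin

text \<open>
In the order \<open>1, z, z\<^sup>-\<^sup>1, z\<^sup>2, z\<^sup>-\<^sup>2, \<dots>\<close> every monomial is obtained from its predecessor by a
reflection \<open>\<sigma>\<close>: either \<open>f(z) \<mapsto> f(z\<^sup>-\<^sup>1)\<close> or \<open>f(z) \<mapsto> z f(z\<^sup>-\<^sup>1)\<close>, in alternation.  This makes the
non-symmetric Jacobi polynomials, up to powers of \<open>z\<close> and reversal, the orthogonal polynomials on the
unit circle for \<open>\<delta>\<^sub>k\<close>, so they obey Szego's recursion
\[E_{j+1} = \sigma_j E_j - \alpha_j E_j ,\]
where \<open>E\<^sub>j\<close> is the polynomial with leading monomial number \<open>j\<close> and the \<open>\<alpha>\<^sub>j\<close> are real numbers, the
Verblunsky coefficients.  As \<open>\<sigma>\<^sub>j\<close> does not change the value at \<open>1\<close>, that value is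
\<open>\<Prod>i<j. (1 - \<alpha>\<^sub>i)\<close>.  The coefficients are
\[\alpha_j = -\frac{k_1}{j+1+k_1+2k_2} \ (j \mbox{ even}), \qquad
  \alpha_j = -\frac{k_1+2k_2}{j+1+k_1+2k_2} \ (j \mbox{ odd}),\]
and the product telescopes to the quotient of \<open>c\<close>-functions by the functional equation of \<open>\<Gamma>\<close>.

What has to be shown is that the polynomials built by this recursion (called \<open>szego j\<close> below) are
orthogonal.  Let \<open>\<phi>\<^sub>j\<close> be the functional \<open>f \<mapsto> (E\<^sub>j, f)\<^sub>k\<close>, recorded by its values on monomials, and let
\[Y = z\frac{d}{dz} + k_1\frac{1-s}{1-z^{-1}} + 2k_2\frac{1-s}{1-z^{-2}}, \qquad (sf)(z) = f(z^{-1}),\]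
be the Cherednik--Dunkl operator.  It is triangular in the ordered monomials, with pairwise different
diagonal entries, the eigenvalues \<open>\<mu>\<^sub>j\<close>.  Each \<open>\<phi>\<^sub>j\<close> satisfies \<open>\<phi>\<^sub>j \<circ> Y = \<mu>\<^sub>j \<phi>\<^sub>j\<close>: for \<open>j = 0\<close> this is a
three-term recurrence for the moments of the weight (\<open>moment_recurrence\<close>), obtained by integrating a
derivative over the circle, and it is inherited from \<open>j\<close> to \<open>j + 1\<close> because the reflections intertwine
\<open>Y\<close> with \<open>- Y\<close> up to a combination of the reflection and the identity (\<open>dunkl_eigenfunctional_reflect\<close> and its shifted form).  Evaluating
\<open>\<phi>\<^sub>j \<circ> Y = \<mu>\<^sub>j \<phi>\<^sub>j\<close> at earlier monomials, one after the other, forces \<open>\<phi>\<^sub>j\<close> to vanish there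
(\<open>pairing_eq_0\<close>).  The squared norms are nonzero, being multiplied by \<open>1 - \<alpha>\<^sub>j\<^sup>2\<close> in each step.
Uniqueness of the Gram--Schmidt process then identifies \<open>szego j\<close> with \<open>jacobi_gram_schmidt k j\<close>
(\<open>gram_schmidt_eq_szego\<close>).
\<close>

lemma basis_exponent_0: "basis_exponent 0 = 0"
  by (simp add: basis_exponent_def)

lemma Gamma_plus1_pos: "x > 0 \<Longrightarrow> Gamma (x + 1) = x * Gamma x" for x :: real
  by (rule Gamma_plus1) (auto elim!: nonpos_Ints_cases)

section \<open>The inner product as an integral over the circle\<close>

locale jacobi_multiplicity =
  fixes k1 k2 :: int
  assumes k1_pos: "k1 > 0" and k2_pos: "k2 > 0"
begin

abbreviation weight :: "complex \<Rightarrow> complex" where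
  "weight \<equiv> jacobi_weight (k1, k2)"

abbreviation jinner :: "(complex \<Rightarrow> complex) \<Rightarrow> (complex \<Rightarrow> complex) \<Rightarrow> complex" where
  "jinner \<equiv> jacobi_inner (k1, k2)"

lemma weight_inverse: "weight (inverse z) = weight z"
proof -
  have "inverse z powi 2 + inverse z powi (-2) = z powi 2 + z powi (-2)"
    by (simp add: power_int_minus power_inverse add.commute)
  then show ?thesis by (simp only: jacobi_weight_def inverse_inverse_eq add.commute)
qed

lemma weight_cis:
  "weight (cis t) = of_real ((1 - cos t) powi k1 * (1 - cos (2 * t)) powi k2)"
proof -
  have "(cis t + inverse (cis t)) / 2 = of_real (cos t)"
    by (simp add: complex_eq_iff cis_inverse)
  moreover have "((cis t) powi 2 + (cis t) powi (-2)) / 2 = of_real (cos (2 * t))"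
    by (simp add: complex_eq_iff power_int_minus Complex.DeMoivre cis_inverse)
  ultimately show ?thesis
    unfolding jacobi_weight_def fst_conv snd_conv by simp
qed

lemma continuous_on_weight: "continuous_on (sphere 0 1) weight"
  unfolding jacobi_weight_def using k1_pos k2_pos
  by (auto intro!: continuous_intros)

lemma continuous_on_compose_cis:
  "continuous_on (sphere 0 1) f \<Longrightarrow> continuous_on S (\<lambda>t. f (cis (2 * pi * t)))"
  by (rule continuous_on_compose2[of "sphere 0 1" f]) (auto intro!: continuous_intros)

lemma inner_eq_integral:
  "jinner f g = 2 * pi * integral {0..1}
     (\<lambda>t. cnj (f (cis (2 * pi * t))) * g (cis (2 * pi * t)) * weight (cis (2 * pi * t)))"
proof -
  have circle: "circlepath 0 1 t = cis (2 * pi * t)" for t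
    by (simp add: circlepath cis_conv_exp mult_ac)
  have "jinner f g = integral {0..1} (\<lambda>t. 2 * pi *
     (cnj (f (cis (2 * pi * t))) * g (cis (2 * pi * t)) * weight (cis (2 * pi * t))))"
    unfolding jacobi_inner_def contour_integral_integral
    by (rule integral_cong)
       (simp add: circle vector_derivative_circlepath01 vector_derivative_circlepath
          cis_conv_exp mult_ac)
  then show ?thesis by simp
qed

lemma inner_cong:
  assumes "\<And>z. norm z = 1 \<Longrightarrow> f z = f' z" "\<And>z. norm z = 1 \<Longrightarrow> g z = g' z"
  shows "jinner f g = jinner f' g'"
  unfolding inner_eq_integral by (simp add: assms)

lemma inner_hermitian: "jinner f g = cnj (jinner g f)"
  unfolding inner_eq_integral by (simp add: integral_cnj weight_cis mult_ac)

lemma inner_integrable: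
  assumes "continuous_on (sphere 0 1) f" "continuous_on (sphere 0 1) g"
  shows "(\<lambda>t. cnj (f (cis (2 * pi * t))) * g (cis (2 * pi * t)) * weight (cis (2 * pi * t)))
    integrable_on {0..1}"
  using assms
  by (auto intro!: integrable_continuous_real continuous_intros continuous_on_compose_cis
      continuous_on_weight)

lemma inner_add_right:
  assumes "continuous_on (sphere 0 1) f" "continuous_on (sphere 0 1) g" "continuous_on (sphere 0 1) h"
  shows "jinner f (\<lambda>z. g z + h z) = jinner f g + jinner f h"
  using integral_add[OF inner_integrable[OF assms(1,2)] inner_integrable[OF assms(1,3)]]
  unfolding inner_eq_integral by (simp add: algebra_simps)

lemma inner_scale_right: "jinner f (\<lambda>z. c * g z) = c * jinner f g"
  unfolding inner_eq_integral
  by (simp flip: integral_mult_right add: mult_ac)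

lemma inner_minus_right: "jinner f (\<lambda>z. - g z) = - jinner f g"
  using inner_scale_right[of f "- 1" g] by simp

lemma inner_sum_right:
  assumes "continuous_on (sphere 0 1) f" "\<And>i. i \<in> A \<Longrightarrow> continuous_on (sphere 0 1) (g i)"
  shows "jinner f (\<lambda>z. \<Sum>i\<in>A. c i * g i z) = (\<Sum>i\<in>A. c i * jinner f (g i))"
  using assms(2)
proof (induction A rule: infinite_finite_induct)
  case (insert x F)
  have "jinner f (\<lambda>z. \<Sum>i\<in>insert x F. c i * g i z)
      = jinner f (\<lambda>z. c x * g x z + (\<Sum>i\<in>F. c i * g i z))"
    using insert by simp
  also have "\<dots> = jinner f (\<lambda>z. c x * g x z) + jinner f (\<lambda>z. \<Sum>i\<in>F. c i * g i z)"
    using insert assms(1) by (intro inner_add_right) (auto intro!: continuous_intros)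
  finally show ?case
    using insert by (simp add: inner_scale_right)
qed (simp_all add: inner_eq_integral)

lemma inner_diff_scale_left:
  assumes "continuous_on (sphere 0 1) f" "continuous_on (sphere 0 1) g" "continuous_on (sphere 0 1) h"
  shows "jinner (\<lambda>z. f z - of_real c * g z) h = jinner f h - of_real c * jinner g h"
proof -
  have "jinner h (\<lambda>z. f z + - of_real c * g z) = jinner h f + jinner h (\<lambda>z. - of_real c * g z)"
    using assms by (intro inner_add_right) (auto intro!: continuous_intros)
  then show ?thesis
    by (simp add: inner_hermitian[of _ h] inner_scale_right inner_minus_right)
qed

text \<open>
The substitution \<open>z \<mapsto> z\<^sup>-\<^sup>1\<close>, which is \<open>t \<mapsto> 1 - t\<close> in the angle, preserves the measure and the weight.
\<close>
lemma inner_inverse: "jinner (\<lambda>z. f (inverse z)) (\<lambda>z. g (inverse z)) = jinner f g"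
proof -
  define F where "F t = cnj (f (cis (2 * pi * t))) * g (cis (2 * pi * t)) * weight (cis (2 * pi * t))" for t
  have inv: "inverse (cis (2 * pi * t)) = cis (2 * pi * (1 - t))" for t
    by (simp add: complex_eq_iff right_diff_distrib)
  have "jinner (\<lambda>z. f (inverse z)) (\<lambda>z. g (inverse z)) = 2 * pi * integral {0..1} (\<lambda>t. F (1 - t))"
    unfolding inner_eq_integral F_def by (subst weight_inverse[symmetric]) (simp only: inv)
  also have "integral {0..1} (\<lambda>t. F (1 - t)) = integral {0..1} F"
    using Henstock_Kurzweil_Integration.integral_reflect_real[of 0 "-1" "\<lambda>t. F (1 + t)"]
      integral_shift_Icc_real[of "-1" 0 F 1] by (simp add: o_def)
  finally show ?thesis by (simp only: inner_eq_integral flip: F_def)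
qed

text \<open>
The weight is continuous and nonnegative, and positive at \<open>z = \<i>\<close>, which is \<open>t = 1/4\<close>.
\<close>
lemma inner_one_one_neq_0: "jinner (\<lambda>z. 1) (\<lambda>z. 1) \<noteq> 0"
proof -
  define W where "W t = (1 - cos (2 * pi * t)) powi k1 * (1 - cos (2 * (2 * pi * t))) powi k2" for t
  have contW: "continuous_on {0..1} W"
    unfolding W_def using k1_pos k2_pos by (auto intro!: continuous_intros)
  have "W t \<ge> 0" for t
    unfolding W_def by (auto intro!: mult_nonneg_nonneg zero_le_power_int)
  moreover have "W (1/4) \<noteq> 0"
    by (simp add: W_def)
  ultimately have "integral {0..1} W \<noteq> 0"
    using contW by (subst integral_eq_0_iff) (auto intro!: bexI[of _ "1/4"])
  moreover have "jinner (\<lambda>z. 1) (\<lambda>z. 1) = 2 * pi * of_real (integral {0..1} W)"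
    using integral_linear[OF integrable_continuous_real[OF contW] bounded_linear_of_real[where 'a=complex]]
    unfolding inner_eq_integral weight_cis W_def[symmetric] by (simp add: o_def)
  ultimately show ?thesis by simp
qed

section \<open>Moments of the weight\<close>

definition moment :: "int \<Rightarrow> complex" where
  "moment n = jinner (\<lambda>z. 1) (\<lambda>z. z powi n)"

lemma moment_uminus: "moment (- n) = moment n"
  unfolding moment_def
  using inner_inverse[of "\<lambda>z. 1" "\<lambda>z. z powi n"]
  by (simp add: power_int_minus power_int_inverse)

text \<open>
The function \<open>z\<^sup>n\<^sup>-\<^sup>1 (1 - z\<^sup>2) \<delta>\<^sub>k(z)\<close> is single-valued on the circle, so its derivative integrates to zero.
The factor \<open>1 - z\<^sup>2\<close> cancels the poles of the logarithmic derivative of the weight: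
\[(1-z^2)\, z\,\delta_k'(z) = -\bigl((k_1+k_2)(1+z)^2 + k_2(1-z)^2\bigr)\,\delta_k(z).\]
\<close>
lemma moment_recurrence:
  "(of_int (n + 1) + of_int k1 + 2 * of_int k2) * moment (n + 1) + 2 * of_int k1 * moment n
     + (of_int k1 + 2 * of_int k2 - of_int (n - 1)) * moment (n - 1) = 0"
proof -
  define A B :: "complex \<Rightarrow> complex"
    where "A z = 1 - (z + inverse z) / 2" and "B z = 1 - (z powi 2 + z powi (-2)) / 2" for z
  define P where "P z = z powi (n - 1) * (1 - z\<^sup>2) * weight z / \<i>" for z
  define Q where "Q z = - ((of_int (n + 1) + of_int k1 + 2 * of_int k2) * z powi (n + 1)
      + (2 * of_int k1 * z powi n + (of_int k1 + 2 * of_int k2 - of_int (n - 1)) * z powi (n - 1)))" for z :: complex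
  have deriv: "(P has_field_derivative (cnj 1 * Q z * weight z / (\<i> * z))) (at z within sphere 0 1)"
    if "z \<in> sphere 0 1" for z
  proof -
    have z: "z \<noteq> 0" using that by auto
    define A' where "A' = - (1 - inverse z ^ 2) / 2"
    define B' where "B' = inverse z ^ 3 - z"
    have dA: "(A has_field_derivative A') (at z within sphere 0 1)"
      unfolding A_def A'_def using z
      by (auto intro!: derivative_eq_intros simp: field_simps power2_eq_square)
    have dB: "(B has_field_derivative B') (at z within sphere 0 1)"
      unfolding B_def B'_def using z
      by (auto intro!: derivative_eq_intros simp: field_simps power_int_minus power_int_def eval_nat_numeral)
    have "((\<lambda>z. z powi (n - 1) * (1 - z\<^sup>2) * (A z powi k1 * B z powi k2) / \<i>) has_field_derivative
       (of_int (n - 1) * z powi (n - 1 - 1) * (1 - z\<^sup>2) * (A z powi k1 * B z powi k2)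
        + z powi (n - 1) * (- 2 * z) * (A z powi k1 * B z powi k2)
        + z powi (n - 1) * (1 - z\<^sup>2) * (of_int k1 * A z powi (k1 - 1) * A' * B z powi k2
             + A z powi k1 * (of_int k2 * B z powi (k2 - 1) * B'))) / \<i>) (at z within sphere 0 1)"
      using z k1_pos k2_pos by (auto intro!: derivative_eq_intros dA dB simp: algebra_simps)
    moreover define X where "X = A z powi (k1 - 1)"
    moreover define Y where "Y = B z powi (k2 - 1)"
    moreover define u where "u = z powi (n - 1)"
    moreover have "A z powi k1 = X * A z" "B z powi k2 = Y * B z"
      using k1_pos k2_pos power_int_minus_mult[of "A z" k1] power_int_minus_mult[of "B z" k2]
      by (auto simp: X_def Y_def)
    moreover have "z powi (n - 1 - 1) = u / z" "z powi n = u * z" "z powi (n + 1) = u * z\<^sup>2"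
      using z power_int_diff[of z "n - 1" 1] power_int_add[of z "n - 1" 1] power_int_add[of z "n - 1" 2]
      by (auto simp: u_def add.commute)
    \<comment> \<open>Both derivatives are now \<open>X * Y * u\<close> times a rational function of \<open>z\<close>.\<close>
    moreover have "A z = - (1 - z)\<^sup>2 / (2 * z)" "B z = - (1 - z\<^sup>2)\<^sup>2 / (2 * z\<^sup>2)"
      unfolding A_def B_def using z
      by (auto simp: field_simps power2_eq_square power_int_minus)
    ultimately have "((\<lambda>z. z powi (n - 1) * (1 - z\<^sup>2) * (A z powi k1 * B z powi k2) / \<i>) has_field_derivative
       (cnj 1 * Q z * (A z powi k1 * B z powi k2) / (\<i> * z))) (at z within sphere 0 1)"
      using z by (elim DERIV_cong, simp add: Q_def A'_def B'_def, simp add: field_simps, simp add: algebra_simps eval_nat_numeral)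
    then show ?thesis
      unfolding P_def jacobi_weight_def A_def B_def fst_conv snd_conv .
  qed
  have "((\<lambda>z. cnj 1 * Q z * weight z / (\<i> * z)) has_contour_integral
      P (pathfinish (circlepath 0 1)) - P (pathstart (circlepath 0 1))) (circlepath 0 1)"
    by (rule contour_integral_primitive[OF deriv]) auto
  then have "jinner (\<lambda>z. 1) Q = 0"
    unfolding jacobi_inner_def by (simp add: contour_integral_unique)
  moreover have "jinner (\<lambda>z. 1) Q = - ((of_int (n + 1) + of_int k1 + 2 * of_int k2) * moment (n + 1)
      + (2 * of_int k1 * moment n + (of_int k1 + 2 * of_int k2 - of_int (n - 1)) * moment (n - 1)))"
    unfolding Q_def moment_def
    by (subst inner_minus_right, subst inner_add_right; (subst inner_add_right)?)
       (auto simp: inner_scale_right intro!: continuous_intros)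
  ultimately show ?thesis by (metis neg_equal_0_iff_equal add.assoc)
qed

section \<open>The Szego recursion\<close>

text \<open>
The reflection \<open>\<sigma>\<^sub>j\<close> sends \<open>z\<^sup>n\<close> to \<open>z\<close> to the power \<open>shift j - n\<close>.
\<close>
definition shift :: "nat \<Rightarrow> int" where
  "shift j = (if even j then 1 else 0)"

definition verblunsky :: "nat \<Rightarrow> real" where
  "verblunsky j = - (of_int k1 + (if even j then 0 else 2 * of_int k2))
     / (of_nat j + 1 + of_int k1 + 2 * of_int k2)"

text \<open>
If \<open>\<Phi>\<^sub>j\<close> denotes the monic orthogonal polynomial of degree \<open>j\<close> on the circle, then \<open>szego (2 * m)\<close> is
\<open>z\<^sup>m \<Phi>\<^sub>2\<^sub>m(z\<^sup>-\<^sup>1)\<close> and \<open>szego (2 * m + 1)\<close> is \<open>z\<^sup>-\<^sup>m \<Phi>\<^sub>2\<^sub>m\<^sub>+\<^sub>1(z)\<close>.  Only the values away from \<open>0\<close> are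
meaningful; at \<open>0\<close> they depend on the convention for \<open>inverse 0\<close>.
\<close>
primrec szego :: "nat \<Rightarrow> complex \<Rightarrow> complex" where
  "szego 0 = (\<lambda>z. 1)"
| "szego (Suc j) = (\<lambda>z. z powi shift j * szego j (inverse z) - of_real (verblunsky j) * szego j z)"

definition pairing :: "nat \<Rightarrow> int \<Rightarrow> complex" where
  "pairing j n = jinner (szego j) (\<lambda>z. z powi n)"

lemma continuous_on_compose_inverse:
  "continuous_on (sphere 0 1) f \<Longrightarrow> continuous_on (sphere 0 (1::real)) (\<lambda>z::complex. f (inverse z))"
  by (rule continuous_on_compose2[of "sphere 0 1" f]) (auto intro!: continuous_intros simp: norm_inverse)

lemma continuous_on_szego [continuous_intros]: "continuous_on (sphere 0 1) (szego j)"
  by (induction j) (auto intro!: continuous_intros continuous_on_compose_inverse)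

lemma continuous_on_powi [continuous_intros]: "continuous_on (sphere 0 1) (\<lambda>z::complex. z powi n)"
  by (auto intro!: continuous_intros)

text \<open>
On the circle a reflection is its own adjoint, since \<open>z\<^sup>d\<close> is conjugate to \<open>z\<^sup>-\<^sup>d\<close> there.
\<close>
lemma inner_reflect:
  "jinner (\<lambda>z. z powi d * f (inverse z)) (\<lambda>z. z powi n) = jinner f (\<lambda>z. z powi (d - n))"
proof -
  have "jinner (\<lambda>z. z powi d * f (inverse z)) (\<lambda>z. z powi n)
      = jinner (\<lambda>z. f (inverse z)) (\<lambda>z. inverse z powi (d - n))"
  proof -
    have "cnj (z powi d * f (inverse z)) * z powi n = cnj (f (inverse z)) * inverse z powi (d - n)"
      if "norm z = 1" for z
    proof -
      have "z \<noteq> 0" using that by auto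
      moreover have "cnj z = inverse z"
        using that by (simp add: inverse_complex_def complex_eq_iff cmod_def)
      ultimately show ?thesis
        by (simp add: power_int_diff power_int_inverse divide_inverse mult_ac)
    qed
    then show ?thesis
      unfolding inner_eq_integral by (simp only: norm_cis)
  qed
  then show ?thesis using inner_inverse[of f "\<lambda>z. z powi (d - n)"] by simp
qed

lemma pairing_0: "pairing 0 = moment"
  by (simp add: pairing_def moment_def fun_eq_iff)

lemma pairing_Suc:
  "pairing (Suc j) n = pairing j (shift j - n) - of_real (verblunsky j) * pairing j n"
proof -
  have "continuous_on (sphere 0 1) (\<lambda>z. z powi shift j * szego j (inverse z))"
    by (auto intro!: continuous_intros continuous_on_compose_inverse)
  then show ?thesis
    unfolding pairing_def szego.simps
    by (subst inner_diff_scale_left) (auto intro!: continuous_intros simp: inner_reflect)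
qed

section \<open>Eigenfunctionals of the Cherednik--Dunkl operator\<close>

text \<open>
This says \<open>\<phi> \<circ> Y = \<mu> \<phi>\<close> for a linear functional \<open>\<phi>\<close> on Laurent polynomials, with \<open>\<phi> n\<close> its value at \<open>z\<^sup>n\<close>,
tested on the spanning set formed by \<open>1\<close>, \<open>z\<close> and all \<open>(z - z\<^sup>-\<^sup>1) z\<^sup>n\<close>.  On \<open>z\<^sup>n\<close> itself the difference
quotients in \<open>Y\<close> are sums of about \<open>2n\<close> monomials, but on \<open>(z - z\<^sup>-\<^sup>1) z\<^sup>n\<close> the denominators cancel against
\<open>z - z\<^sup>-\<^sup>1\<close>, which is odd under \<open>s\<close>, and leave the terms \<open>(z + 1) (z\<^sup>n + z\<^sup>-\<^sup>n)\<close> and \<open>z (z\<^sup>n + z\<^sup>-\<^sup>n)\<close>.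
\<close>
definition dunkl_eigenfunctional :: "complex \<Rightarrow> (int \<Rightarrow> complex) \<Rightarrow> bool" where
  "dunkl_eigenfunctional \<mu> \<phi> \<longleftrightarrow>
     \<mu> * \<phi> 0 = 0 \<and>
     (1 + of_int k1 + 2 * of_int k2 - \<mu>) * \<phi> 1 + of_int k1 * \<phi> 0 = 0 \<and>
     (\<forall>n. (of_int (n + 1) - \<mu>) * \<phi> (n + 1) - (of_int (n - 1) - \<mu>) * \<phi> (n - 1)
        + of_int k1 * (\<phi> (n + 1) + \<phi> n + \<phi> (- n) + \<phi> (1 - n))
        + 2 * of_int k2 * (\<phi> (n + 1) + \<phi> (1 - n)) = 0)"

text \<open>
Since the moments are even in \<open>n\<close>, the eigenvalue equation for \<open>\<mu> = 0\<close> is the moment recurrence.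
\<close>
lemma dunkl_eigenfunctional_moment: "dunkl_eigenfunctional 0 moment"
  unfolding dunkl_eigenfunctional_def
proof (intro conjI allI)
  show "(1 + of_int k1 + 2 * of_int k2 - 0) * moment 1 + of_int k1 * moment 0 = 0"
  proof -
    have "2 * ((1 + of_int k1 + 2 * of_int k2 - 0) * moment 1 + of_int k1 * moment 0) = 0"
      using moment_recurrence[of 0] moment_uminus[of 1] by (simp add: algebra_simps)
    then show ?thesis by (simp only: mult_eq_0_iff) simp
  qed
  fix n
  have "moment (1 - n) = moment (n - 1)"
    using moment_uminus[of "n - 1"] by simp
  then show "(of_int (n + 1) - 0) * moment (n + 1) - (of_int (n - 1) - 0) * moment (n - 1)
        + of_int k1 * (moment (n + 1) + moment n + moment (- n) + moment (1 - n))
        + 2 * of_int k2 * (moment (n + 1) + moment (1 - n)) = 0"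
    using moment_recurrence[of n] by (simp add: moment_uminus algebra_simps)
qed simp

text \<open>
With \<open>(\<tau>f)(z) = z f(z\<^sup>-\<^sup>1)\<close> one has \<open>\<tau>Y + Y\<tau> = (1 + k\<^sub>1 + 2k\<^sub>2) \<tau> + k\<^sub>1\<close>.  So \<open>Y\<close> preserves the span of \<open>\<phi>\<close> and
\<open>\<phi> \<circ> \<tau>\<close>, and the condition on \<open>r\<close> makes \<open>\<phi> \<circ> \<tau> - r \<phi>\<close> the second eigenvector in it.  In the spanning set
above, \<open>\<tau>\<close> maps \<open>(z - z\<^sup>-\<^sup>1) z\<^sup>n\<close> to \<open>- (z - z\<^sup>-\<^sup>1) z\<^sup>1\<^sup>-\<^sup>n\<close>, so the equation at \<open>n\<close> for the new functional is
a combination of those at \<open>n\<close> and \<open>1 - n\<close> for the old one.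
\<close>
lemma dunkl_eigenfunctional_reflect_shifted:
  assumes "dunkl_eigenfunctional \<mu> \<phi>" and r: "r * (2 * \<mu> - 1 - of_int k1 - 2 * of_int k2) = of_int k1"
  shows "dunkl_eigenfunctional (1 + of_int k1 + 2 * of_int k2 - \<mu>) (\<lambda>n. \<phi> (1 - n) - r * \<phi> n)"
proof -
  have e0: "\<mu> * \<phi> 0 = 0" and e1: "(1 + of_int k1 + 2 * of_int k2 - \<mu>) * \<phi> 1 + of_int k1 * \<phi> 0 = 0"
    and e: "(of_int (n + 1) - \<mu>) * \<phi> (n + 1) - (of_int (n - 1) - \<mu>) * \<phi> (n - 1)
        + of_int k1 * (\<phi> (n + 1) + \<phi> n + \<phi> (- n) + \<phi> (1 - n))
        + 2 * of_int k2 * (\<phi> (n + 1) + \<phi> (1 - n)) = 0" for n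
    using assms(1) unfolding dunkl_eigenfunctional_def by auto
  have "(1 + of_int k1 + 2 * of_int k2 - \<mu>) * (\<phi> 1 - r * \<phi> 0) = 0"
    using e0 e1 r by algebra
  moreover have "\<mu> * (\<phi> 0 - r * \<phi> 1) + of_int k1 * (\<phi> 1 - r * \<phi> 0) = 0"
    using e0 e1 r by algebra
  moreover have "(of_int n + 1 - (1 + of_int k1 + 2 * of_int k2 - \<mu>)) * (\<phi> (- n) - r * \<phi> (n + 1))
        - (of_int n - 1 - (1 + of_int k1 + 2 * of_int k2 - \<mu>)) * (\<phi> (2 - n) - r * \<phi> (n - 1))
        + of_int k1 * ((\<phi> (- n) - r * \<phi> (n + 1)) + (\<phi> (1 - n) - r * \<phi> n)
             + (\<phi> (n + 1) - r * \<phi> (- n)) + (\<phi> n - r * \<phi> (1 - n)))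
        + 2 * of_int k2 * ((\<phi> (- n) - r * \<phi> (n + 1)) + (\<phi> n - r * \<phi> (1 - n))) = 0" for n
  proof -
    have "(2 - of_int n - \<mu>) * \<phi> (2 - n) + (of_int n + \<mu>) * \<phi> (- n)
        + of_int k1 * (\<phi> (2 - n) + \<phi> (1 - n) + \<phi> (n - 1) + \<phi> n)
        + 2 * of_int k2 * (\<phi> (2 - n) + \<phi> n) = 0"
      using e[of "1 - n"] by (simp add: algebra_simps)
    moreover have "(of_int n + 1 - \<mu>) * \<phi> (n + 1) - (of_int n - 1 - \<mu>) * \<phi> (n - 1)
        + of_int k1 * (\<phi> (n + 1) + \<phi> n + \<phi> (- n) + \<phi> (1 - n))
        + 2 * of_int k2 * (\<phi> (n + 1) + \<phi> (1 - n)) = 0"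
      using e[of n] by simp
    ultimately show ?thesis using r by algebra
  qed
  ultimately show ?thesis
    unfolding dunkl_eigenfunctional_def by (simp add: add.commute)
qed

text \<open>
The same argument with \<open>s\<close>, for which \<open>sY + Ys = (k\<^sub>1 + 2k\<^sub>2) (s - 1)\<close>; the equation at \<open>n\<close> comes from those
at \<open>n\<close> and \<open>- n\<close>.
\<close>
lemma dunkl_eigenfunctional_reflect:
  assumes "dunkl_eigenfunctional \<mu> \<phi>" and r: "r * (of_int k1 + 2 * of_int k2 - 2 * \<mu>) = of_int k1 + 2 * of_int k2"
  shows "dunkl_eigenfunctional (of_int k1 + 2 * of_int k2 - \<mu>) (\<lambda>n. \<phi> (- n) - r * \<phi> n)"
proof -
  have e0: "\<mu> * \<phi> 0 = 0" and e1: "(1 + of_int k1 + 2 * of_int k2 - \<mu>) * \<phi> 1 + of_int k1 * \<phi> 0 = 0"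
    and e: "(of_int (n + 1) - \<mu>) * \<phi> (n + 1) - (of_int (n - 1) - \<mu>) * \<phi> (n - 1)
        + of_int k1 * (\<phi> (n + 1) + \<phi> n + \<phi> (- n) + \<phi> (1 - n))
        + 2 * of_int k2 * (\<phi> (n + 1) + \<phi> (1 - n)) = 0" for n
    using assms(1) unfolding dunkl_eigenfunctional_def by auto
  \<comment> \<open>The equation at \<open>z - z\<^sup>-\<^sup>1\<close>: reflecting the test polynomial \<open>z\<close> gives \<open>z\<^sup>-\<^sup>1\<close>, and this relates the two.\<close>
  have e0': "(1 - \<mu>) * \<phi> 1 + (1 + \<mu>) * \<phi> (-1) + of_int k1 * (2 * \<phi> 1 + 2 * \<phi> 0) + 4 * of_int k2 * \<phi> 1 = 0"
    using e[of 0] by (simp add: algebra_simps)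
  have "(of_int k1 + 2 * of_int k2 - \<mu>) * (\<phi> 0 - r * \<phi> 0) = 0"
    using e0 r by algebra
  moreover have "(1 + \<mu>) * (\<phi> (- 1) - r * \<phi> 1) + of_int k1 * (\<phi> 0 - r * \<phi> 0) = 0"
    using e0 e1 e0' r by algebra
  moreover have "(of_int n + 1 - (of_int k1 + 2 * of_int k2 - \<mu>)) * (\<phi> (- n - 1) - r * \<phi> (n + 1))
        - (of_int n - 1 - (of_int k1 + 2 * of_int k2 - \<mu>)) * (\<phi> (1 - n) - r * \<phi> (n - 1))
        + of_int k1 * ((\<phi> (- n - 1) - r * \<phi> (n + 1)) + (\<phi> (- n) - r * \<phi> n)
             + (\<phi> n - r * \<phi> (- n)) + (\<phi> (n - 1) - r * \<phi> (1 - n)))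
        + 2 * of_int k2 * ((\<phi> (- n - 1) - r * \<phi> (n + 1)) + (\<phi> (n - 1) - r * \<phi> (1 - n))) = 0" for n
  proof -
    have "(1 - of_int n - \<mu>) * \<phi> (1 - n) + (of_int n + 1 + \<mu>) * \<phi> (- n - 1)
        + of_int k1 * (\<phi> (1 - n) + \<phi> (- n) + \<phi> n + \<phi> (n + 1))
        + 2 * of_int k2 * (\<phi> (1 - n) + \<phi> (n + 1)) = 0"
      using e[of "- n"] by (simp add: algebra_simps)
    moreover have "(of_int n + 1 - \<mu>) * \<phi> (n + 1) - (of_int n - 1 - \<mu>) * \<phi> (n - 1)
        + of_int k1 * (\<phi> (n + 1) + \<phi> n + \<phi> (- n) + \<phi> (1 - n))
        + 2 * of_int k2 * (\<phi> (n + 1) + \<phi> (1 - n)) = 0"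
      using e[of n] by simp
    ultimately show ?thesis using r by algebra
  qed
  ultimately show ?thesis
    unfolding dunkl_eigenfunctional_def by (simp add: add.commute)
qed

text \<open>
The diagonal entry of \<open>Y\<close> at the monomial number \<open>j\<close>: it is \<open>m + k\<^sub>1 + 2k\<^sub>2\<close> at \<open>z\<^sup>m\<close> for \<open>m > 0\<close> and
\<open>- m\<close> at \<open>z\<^sup>-\<^sup>m\<close> for \<open>m \<ge> 0\<close>.
\<close>
definition dunkl_eigenvalue :: "nat \<Rightarrow> real" where
  "dunkl_eigenvalue j = (if odd j then of_int k1 + 2 * of_int k2 + (of_nat j + 1) / 2 else - (of_nat j / 2))"

text \<open>
The Verblunsky coefficients are the values of \<open>r\<close> that the two reflection lemmas ask for, at the
eigenvalue reached in step \<open>j\<close>.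
\<close>
lemma dunkl_eigenfunctional_pairing:
  "dunkl_eigenfunctional (of_real (dunkl_eigenvalue j)) (pairing j)"
proof (induction j)
  case 0
  then show ?case by (simp add: pairing_0 dunkl_eigenfunctional_moment dunkl_eigenvalue_def)
next
  case (Suc j)
  have pos: "real j + 1 + of_int k1 + 2 * of_int k2 > 0"
    using k1_pos k2_pos by (simp add: add_pos_pos)
  define L where "L = dunkl_eigenvalue j"
  define r where "r = verblunsky j"
  show ?case
  proof (cases "even j")
    case True
    have "r * (2 * L - 1 - of_int k1 - 2 * of_int k2) = of_int k1"
      using pos True by (simp add: r_def L_def verblunsky_def dunkl_eigenvalue_def field_simps)
    then have "complex_of_real (r * (2 * L - 1 - of_int k1 - 2 * of_int k2)) = of_real (of_int k1)"
      by simp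
    moreover have "dunkl_eigenvalue (Suc j) = 1 + of_int k1 + 2 * of_int k2 - L"
      using True by (simp add: L_def dunkl_eigenvalue_def)
    ultimately show ?thesis
      using dunkl_eigenfunctional_reflect_shifted[OF Suc, of "of_real r"] True
      by (simp add: pairing_Suc[abs_def] shift_def L_def r_def)
  next
    case False
    have "r * (of_int k1 + 2 * of_int k2 - 2 * L) = of_int k1 + 2 * of_int k2"
      using pos False by (simp add: r_def L_def verblunsky_def dunkl_eigenvalue_def field_simps)
    then have "complex_of_real (r * (of_int k1 + 2 * of_int k2 - 2 * L)) = of_real (of_int k1 + 2 * of_int k2)"
      by simp
    moreover have "dunkl_eigenvalue (Suc j) = of_int k1 + 2 * of_int k2 - L"
      using False by (simp add: L_def dunkl_eigenvalue_def field_simps)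
    ultimately show ?thesis
      using dunkl_eigenfunctional_reflect[OF Suc, of "of_real r"] False
      by (simp add: pairing_Suc[abs_def] shift_def L_def r_def)
  qed
qed

section \<open>Orthogonality\<close>

lemma basis_exponent_Suc: "basis_exponent (Suc j) = shift j - basis_exponent j"
  by (cases "even j") (auto simp: basis_exponent_def shift_def elim!: evenE oddE)

lemma dunkl_eigenvalue_inj: "dunkl_eigenvalue i = dunkl_eigenvalue j \<Longrightarrow> i = j"
  using k1_pos k2_pos unfolding dunkl_eigenvalue_def by (auto split: if_splits simp: field_simps)

text \<open>
Triangularity of \<open>Y\<close>: once \<open>\<phi>\<close> vanishes at all earlier monomials, the eigenvalue equation reduces to
\<open>(\<mu>\<^sub>j - \<mu>) \<phi>(z\<^sup>n) = 0\<close> at the monomial \<open>z\<^sup>n\<close> number \<open>j\<close>.  For \<open>n = - m < 0\<close> the test polynomial to use is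
\<open>z\<^sup>2\<^sup>-\<^sup>m - z\<^sup>-\<^sup>m\<close>, and for \<open>n = m + 1 > 1\<close> it is \<open>z\<^sup>m\<^sup>+\<^sup>1 - z\<^sup>m\<^sup>-\<^sup>1\<close>: besides \<open>z\<^sup>n\<close>, only earlier monomials
enter.
\<close>
lemma dunkl_eigenfunctional_vanishes_at:
  assumes eigen: "dunkl_eigenfunctional \<mu> \<phi>" and ne: "\<mu> \<noteq> of_real (dunkl_eigenvalue j)"
    and vanish: "\<And>i. i < j \<Longrightarrow> \<phi> (basis_exponent i) = 0"
  shows "\<phi> (basis_exponent j) = 0"
proof -
  have zero: "\<phi> n = 0" if "basis_position n < j" for n
    using vanish[OF that] by (simp add: basis_exponent_position)
  have e: "(of_int (n + 1) - \<mu>) * \<phi> (n + 1) - (of_int (n - 1) - \<mu>) * \<phi> (n - 1)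
        + of_int k1 * (\<phi> (n + 1) + \<phi> n + \<phi> (- n) + \<phi> (1 - n))
        + 2 * of_int k2 * (\<phi> (n + 1) + \<phi> (1 - n)) = 0" for n
    using eigen unfolding dunkl_eigenfunctional_def by auto
  consider "j = 0" | "j = 1" | m where "j = 2 * m" "m \<ge> 1" | m where "j = 2 * m + 1" "m \<ge> 1"
    by (cases "even j") (fastforce elim!: evenE oddE)+
  then show ?thesis
  proof cases
    case 1
    then show ?thesis
      using eigen ne by (auto simp: dunkl_eigenfunctional_def dunkl_eigenvalue_def basis_exponent_0)
  next
    case 2
    then show ?thesis
    proof -
      have "(1 + of_int k1 + 2 * of_int k2 - \<mu>) * \<phi> 1 = 0"
        using eigen zero[of 0] 2 by (simp add: dunkl_eigenfunctional_def basis_position_def)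
      moreover have "complex_of_real (dunkl_eigenvalue j) = 1 + of_int k1 + 2 * of_int k2"
        using 2 by (simp add: dunkl_eigenvalue_def)
      ultimately show ?thesis
        using 2 ne by (simp add: basis_exponent_def)
    qed
  next
    case (3 m)
    have "\<phi> (2 - int m) = 0" "\<phi> (1 - int m) = 0" "\<phi> (int m - 1) = 0" "\<phi> (int m) = 0"
      using 3 by (auto intro!: zero simp: basis_position_def)
    then have "(- of_nat m - \<mu>) * \<phi> (- int m) = 0"
      using e[of "1 - int m"] by simp
    moreover have "complex_of_real (dunkl_eigenvalue j) = - of_nat m"
      using 3 by (simp add: dunkl_eigenvalue_def)
    ultimately show ?thesis
      using 3 ne by (auto simp: basis_exponent_def)
  next
    case (4 m)
    have "\<phi> (int m - 1) = 0" "\<phi> (int m) = 0" "\<phi> (- int m) = 0" "\<phi> (1 - int m) = 0"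
      using 4 by (auto intro!: zero simp: basis_position_def)
    then have "(of_nat m + 1 + of_int k1 + 2 * of_int k2 - \<mu>) * \<phi> (int m + 1) = 0"
      using e[of "int m"] by (simp add: algebra_simps)
    moreover have "complex_of_real (dunkl_eigenvalue j) = of_nat m + 1 + of_int k1 + 2 * of_int k2"
      using 4 by (simp add: dunkl_eigenvalue_def add_divide_distrib)
    ultimately show ?thesis
      using 4 ne by (auto simp: basis_exponent_def add.commute)
  qed
qed

lemma pairing_eq_0: "i < j \<Longrightarrow> pairing j (basis_exponent i) = 0"
proof (induction i rule: less_induct)
  case (less i)
  show ?case
  proof (rule dunkl_eigenfunctional_vanishes_at[OF dunkl_eigenfunctional_pairing])
    show "complex_of_real (dunkl_eigenvalue j) \<noteq> complex_of_real (dunkl_eigenvalue i)"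
      using dunkl_eigenvalue_inj less.prems by fastforce
  qed (use less in auto)
qed

lemma verblunsky_bounds: "- 1 < verblunsky j" "verblunsky j < 1"
proof -
  have "0 < (of_int k1 :: real)" "0 < (of_int k2 :: real)"
    using k1_pos k2_pos by auto
  moreover from this have "0 < real j + 1 + of_int k1 + 2 * of_int k2" by simp
  ultimately show "- 1 < verblunsky j" "verblunsky j < 1"
    by (auto simp: verblunsky_def field_simps)
qed

text \<open>
The usual norm recursion \<open>h\<^sub>j\<^sub>+\<^sub>1 = (1 - \<alpha>\<^sub>j\<^sup>2) h\<^sub>j\<close> for \<open>h\<^sub>j = \<phi>\<^sub>j(e\<^sub>j)\<close>, where \<open>e\<^sub>j\<close> is the monomial number \<open>j\<close>.
It follows from orthogonality at the next step: \<open>\<sigma>\<^sub>j\<close> exchanges \<open>e\<^sub>j\<close> and \<open>e\<^sub>j\<^sub>+\<^sub>1\<close>, so \<open>\<phi>\<^sub>j\<^sub>+\<^sub>1(e\<^sub>j) = 0\<close> reads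
\<open>\<phi>\<^sub>j(e\<^sub>j\<^sub>+\<^sub>1) = \<alpha>\<^sub>j h\<^sub>j\<close>.
\<close>
lemma pairing_diag_neq_0: "pairing j (basis_exponent j) \<noteq> 0"
proof (induction j)
  case 0
  then show ?case using inner_one_one_neq_0 by (simp add: pairing_def basis_exponent_0)
next
  case (Suc j)
  define r where "r = complex_of_real (verblunsky j)"
  define h where "h = pairing j (basis_exponent j)"
  have "pairing j (basis_exponent (Suc j)) = r * h"
    using pairing_eq_0[of j "Suc j"]
    by (simp add: pairing_Suc basis_exponent_Suc r_def h_def)
  then have "pairing (Suc j) (basis_exponent (Suc j)) = of_real (1 - (verblunsky j)\<^sup>2) * h"
    by (simp add: pairing_Suc basis_exponent_Suc r_def h_def algebra_simps power2_eq_square)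
  moreover have "(verblunsky j)\<^sup>2 < 1"
    using verblunsky_bounds[of j] by (simp add: abs_square_less_1 abs_less_iff)
  ultimately show ?case
    using Suc by (simp only: h_def mult_eq_0_iff of_real_eq_0_iff) auto
qed

section \<open>Identification with the Gram--Schmidt process\<close>

text \<open>
The first \<open>j\<close> exponents form an interval whose end points add up to \<open>shift j\<close>, so \<open>\<sigma>\<^sub>j\<close> permutes them.
\<close>
lemma basis_position_reflect_less:
  "i < j \<Longrightarrow> basis_position (shift j - basis_exponent i) < j"
  by (cases "even i"; cases "even j")
     (auto simp: basis_position_def shift_def basis_exponent_def elim!: evenE oddE)

text \<open>
\<open>\<sigma>\<^sub>j\<close> sends the leading monomial of \<open>szego j\<close> to the next one and permutes the earlier monomials.
\<close>
lemma szego_expansion: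
  "\<exists>a. \<forall>z. z \<noteq> 0 \<longrightarrow> szego j z = z powi basis_exponent j + (\<Sum>i<j. a i * z powi basis_exponent i)"
proof (induction j)
  case 0
  then show ?case by (simp add: basis_exponent_0)
next
  case (Suc j)
  then obtain a where a: "\<And>z. z \<noteq> 0 \<Longrightarrow>
      szego j z = z powi basis_exponent j + (\<Sum>i<j. a i * z powi basis_exponent i)" by blast
  define r where "r = complex_of_real (verblunsky j)"
  define \<tau> where "\<tau> i = basis_position (shift j - basis_exponent i)" for i
  define b where "b i = (if i < j then a (\<tau> i) - r * a i else - r)" for i
  have "szego (Suc j) z = z powi basis_exponent (Suc j) + (\<Sum>i<Suc j. b i * z powi basis_exponent i)"
    if z: "z \<noteq> 0" for z
  proof -
    have refl: "z powi shift j * inverse z powi n = z powi (shift j - n)" for n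
      using z by (simp add: power_int_diff power_int_inverse divide_inverse)
    have "szego (Suc j) z = z powi shift j * inverse z powi basis_exponent j
        + (\<Sum>i<j. a i * (z powi shift j * inverse z powi basis_exponent i))
        - r * (z powi basis_exponent j + (\<Sum>i<j. a i * z powi basis_exponent i))"
      using z by (simp add: a r_def algebra_simps sum_distrib_left)
    also have "(\<Sum>i<j. a i * (z powi shift j * inverse z powi basis_exponent i))
        = (\<Sum>i<j. a i * z powi (shift j - basis_exponent i))"
      by (simp only: refl)
    also have "\<dots> = (\<Sum>i<j. a (\<tau> i) * z powi basis_exponent i)"
      by (rule sum.reindex_bij_witness[of _ \<tau> \<tau>])
         (auto simp: \<tau>_def basis_position_reflect_less basis_position_exponent basis_exponent_position)
    finally show ?thesis
      by (simp add: refl basis_exponent_Suc b_def algebra_simps sum_subtractf sum_distrib_left)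
  qed
  then show ?case by blast
qed

lemma monomials_in_span_szego:
  "\<exists>b. \<forall>z. z \<noteq> 0 \<longrightarrow> (\<Sum>i<j. a i * z powi basis_exponent i) = (\<Sum>i<j. b i * szego i z)"
proof (induction j arbitrary: a)
  case (Suc j)
  obtain c where c: "\<And>z. z \<noteq> 0 \<Longrightarrow>
      szego j z = z powi basis_exponent j + (\<Sum>i<j. c i * z powi basis_exponent i)"
    using szego_expansion by blast
  obtain b where b: "\<And>z. z \<noteq> 0 \<Longrightarrow>
      (\<Sum>i<j. (a i - a j * c i) * z powi basis_exponent i) = (\<Sum>i<j. b i * szego i z)"
    using Suc[of "\<lambda>i. a i - a j * c i"] by blast
  have "(\<Sum>i<Suc j. a i * z powi basis_exponent i) = (\<Sum>i<Suc j. (b(j := a j)) i * szego i z)"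
    if z: "z \<noteq> 0" for z
  proof -
    have "(\<Sum>i<Suc j. (b(j := a j)) i * szego i z)
        = (\<Sum>i<j. (a i - a j * c i) * z powi basis_exponent i) + a j * szego j z"
      using z by (simp add: b)
    then show ?thesis
      using z by (simp add: c algebra_simps sum_subtractf sum_distrib_left)
  qed
  then show ?case by blast
qed simp

text \<open>
Only the leading monomial of \<open>szego i\<close> can contribute, because \<open>szego j\<close> is orthogonal to the earlier ones.
\<close>
lemma inner_szego_le:
  assumes "i \<le> j"
  shows "jinner (szego j) (szego i) = (if i = j then pairing j (basis_exponent j) else 0)"
proof -
  obtain a where a: "\<And>z. z \<noteq> 0 \<Longrightarrow>
      szego i z = z powi basis_exponent i + (\<Sum>l<i. a l * z powi basis_exponent l)"
    using szego_expansion by blast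
  have "jinner (szego j) (szego i)
      = jinner (szego j) (\<lambda>z. z powi basis_exponent i + (\<Sum>l<i. a l * z powi basis_exponent l))"
    by (rule inner_cong) (auto intro!: a)
  also have "\<dots> = pairing j (basis_exponent i) + (\<Sum>l<i. a l * pairing j (basis_exponent l))"
    unfolding pairing_def
    by (subst inner_add_right, (auto intro!: continuous_intros)[3],
        subst inner_sum_right) (auto intro!: continuous_intros)
  also have "(\<Sum>l<i. a l * pairing j (basis_exponent l)) = 0"
    using assms by (intro sum.neutral) (auto simp: pairing_eq_0)
  finally show ?thesis
    using assms by (auto simp: pairing_eq_0)
qed

lemma inner_szego_eq_0: "i \<noteq> j \<Longrightarrow> jinner (szego i) (szego j) = 0"
  using inner_szego_le[of i j] inner_szego_le[of j i] inner_hermitian[of "szego i" "szego j"]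
  by (cases "i \<le> j") auto

text \<open>
Expanding the monomial number \<open>j\<close> as \<open>szego j\<close> plus a combination of the earlier \<open>szego i\<close>, orthogonality
shows that the coefficients of this combination are the ones that Gram--Schmidt subtracts.
\<close>
lemma gram_schmidt_eq_szego:
  "z \<noteq> 0 \<Longrightarrow> jacobi_gram_schmidt (k1, k2) j z = szego j z"
proof (induction j arbitrary: z rule: less_induct)
  case (less j)
  define e where "e = (\<lambda>w::complex. w powi basis_exponent j)"
  obtain a where a: "\<And>w. w \<noteq> 0 \<Longrightarrow>
      szego j w = w powi basis_exponent j + (\<Sum>i<j. a i * w powi basis_exponent i)"
    using szego_expansion by blast
  obtain b where b: "\<And>w. w \<noteq> 0 \<Longrightarrow>
      (\<Sum>i<j. a i * w powi basis_exponent i) = (\<Sum>i<j. b i * szego i w)"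
    using monomials_in_span_szego by blast
  have e: "e w = szego j w + (\<Sum>i<j. - b i * szego i w)" if "w \<noteq> 0" for w
    using a[OF that] b[OF that] by (simp add: e_def sum_negf)
  have coeff: "jinner (jacobi_gram_schmidt (k1, k2) i) e
      / jinner (jacobi_gram_schmidt (k1, k2) i) (jacobi_gram_schmidt (k1, k2) i) = - b i"
    if i: "i < j" for i
  proof -
    have eq: "jacobi_gram_schmidt (k1, k2) i w = szego i w" if "norm w = 1" for w
      using less.IH[OF i, of w] that by force
    have "jinner (jacobi_gram_schmidt (k1, k2) i) e
        = jinner (szego i) (\<lambda>w. szego j w + (\<Sum>l<j. - b l * szego l w))"
      by (rule inner_cong, simp add: eq, rule e, auto)
    also have "\<dots> = jinner (szego i) (szego j) + (\<Sum>l<j. - b l * jinner (szego i) (szego l))"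
      by (subst inner_add_right, (auto intro!: continuous_intros)[3],
          subst inner_sum_right) (auto intro!: continuous_intros)
    also have "(\<Sum>l<j. - b l * jinner (szego i) (szego l))
        = (\<Sum>l<j. if l = i then - b i * jinner (szego i) (szego i) else 0)"
      by (rule sum.cong) (auto simp: inner_szego_eq_0)
    also have "jinner (szego i) (szego j) + \<dots> = - b i * jinner (szego i) (szego i)"
      using i by (simp add: inner_szego_eq_0)
    finally have "jinner (jacobi_gram_schmidt (k1, k2) i) e = - b i * jinner (szego i) (szego i)" .
    moreover have "jinner (jacobi_gram_schmidt (k1, k2) i) (jacobi_gram_schmidt (k1, k2) i)
        = jinner (szego i) (szego i)"
      by (rule inner_cong) (auto simp: eq)
    moreover have "jinner (szego i) (szego i) \<noteq> 0"
      by (simp add: inner_szego_le pairing_diag_neq_0)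
    ultimately show ?thesis by simp
  qed
  have "jacobi_gram_schmidt (k1, k2) j z = e z - (\<Sum>i<j. - b i * szego i z)"
    using less.prems less.IH coeff
    by (subst jacobi_gram_schmidt.simps) (simp add: e_def)
  then show ?case
    using e[OF less.prems] by simp
qed

section \<open>The value at the identity\<close>

definition \<rho> :: real where "\<rho> = rho (k1, k2)"

lemma szego_at_1_Suc: "szego (Suc j) 1 = of_real (1 - verblunsky j) * szego j 1"
  by (simp add: algebra_simps)

text \<open>
Passing from \<open>z\<^sup>-\<^sup>m\<close> to \<open>z\<^sup>m\<^sup>+\<^sup>1\<close>.  With \<open>t = m + \<rho>\<close> the factor \<open>1 - \<alpha>\<^sub>2\<^sub>m\<close> is \<open>(t + k\<^sub>1/2 + 1/2) / (t + 1/2)\<close>,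
which is what the functional equation of \<open>\<Gamma>\<close> produces when \<open>t + 1/2\<close> and \<open>t + k\<^sub>1/2 + 1/2\<close> increase by one.
\<close>
lemma c_tilde_step_even:
  "(1 - verblunsky (2 * m)) / c_tilde WRefl (of_nat m + \<rho>) (k1, k2)
     = 1 / c_tilde WId (of_nat (Suc m) + \<rho>) (k1, k2)"
proof -
  define t where "t = of_nat m + \<rho>"
  define a b where "a = (of_int k1 / 2 :: real)" and "b = (of_int k2 :: real)"
  have pos: "a > 0" "b > 0" "t > 0"
    using k1_pos k2_pos by (auto simp: a_def b_def t_def \<rho>_def rho_def add_nonneg_pos)
  have t2: "2 * t = 2 * real m + 2 * a + 2 * b"
    by (simp add: t_def \<rho>_def rho_def a_def b_def)
  have "verblunsky (2 * m) = - 2 * a / (2 * t + 1)"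
    unfolding t2 by (simp add: verblunsky_def a_def b_def add_ac)
  then have v: "1 - verblunsky (2 * m) = (t + a + 1/2) / (t + 1/2)"
    using pos by (simp add: field_simps)
  have "Gamma (t + 1 + 1/2) = (t + 1/2) * Gamma (t + 1/2)"
    using pos Gamma_plus1_pos[of "t + 1/2"] by (simp add: add_ac)
  moreover have "Gamma (t + 1 + a + 1/2) = (t + a + 1/2) * Gamma (t + a + 1/2)"
    using pos Gamma_plus1_pos[of "t + a + 1/2"] by (simp add: add_ac)
  moreover have "Gamma (t + 1 + a + b) = Gamma (t + a + b + 1)" by (simp add: add_ac)
  moreover have "Gamma (t + 1/2) > 0" "Gamma (t + a + 1/2) > 0" "Gamma (t + 1) > 0" "Gamma (t + a + b + 1) > 0"
    using pos by (auto intro!: Gamma_real_pos)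
  moreover have t1: "of_nat (Suc m) + \<rho> = t + 1" by (simp add: t_def)
  ultimately show ?thesis
    unfolding v t1 t_def[symmetric] using pos
    by (simp add: c_tilde_def Let_def mult_ac flip: a_def b_def)
qed

text \<open>
Passing from \<open>z\<^sup>m\<^sup>+\<^sup>1\<close> to \<open>z\<^sup>-\<^sup>m\<^sup>-\<^sup>1\<close>.  Here \<open>t = m + 1 + \<rho>\<close> is the same on both sides, only the type of the
\<open>c\<close>-function changes, and the factor is \<open>(t + k\<^sub>1/2 + k\<^sub>2) / t\<close>.
\<close>
lemma c_tilde_step_odd:
  "(1 - verblunsky (2 * m + 1)) / c_tilde WId (of_nat (Suc m) + \<rho>) (k1, k2)
     = 1 / c_tilde WRefl (of_nat (Suc m) + \<rho>) (k1, k2)"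
proof -
  define t where "t = of_nat (Suc m) + \<rho>"
  define a b where "a = (of_int k1 / 2 :: real)" and "b = (of_int k2 :: real)"
  have pos: "a > 0" "b > 0" "t > 0"
    using k1_pos k2_pos by (auto simp: a_def b_def t_def \<rho>_def rho_def add_nonneg_pos)
  have t2: "2 * t = 2 * real m + 2 + 2 * a + 2 * b"
    by (simp add: t_def \<rho>_def rho_def a_def b_def)
  have "verblunsky (2 * m + 1) = - (2 * a + 2 * b) / (2 * t)"
    unfolding t2 by (simp add: verblunsky_def a_def b_def add_ac)
  then have v: "1 - verblunsky (2 * m + 1) = (t + a + b) / t"
    using pos by (simp add: field_simps)
  have "Gamma (t + 1) = t * Gamma t"
    using pos Gamma_plus1_pos[of t] by simp
  moreover have "Gamma (t + a + b + 1) = (t + a + b) * Gamma (t + a + b)"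
    using pos Gamma_plus1_pos[of "t + a + b"] by simp
  moreover have "Gamma (t + 1/2) > 0" "Gamma (t + a + 1/2) > 0" "Gamma t > 0" "Gamma (t + a + b) > 0"
    using pos by (auto intro!: Gamma_real_pos)
  ultimately show ?thesis
    unfolding v t_def[symmetric] using pos
    by (simp add: c_tilde_def Let_def mult_ac flip: a_def b_def)
qed

lemma c_tilde_rho_neq_0: "c_tilde WRefl \<rho> (k1, k2) \<noteq> 0"
proof -
  have "(of_int k1 :: real) > 0" "(of_int k2 :: real) > 0" using k1_pos k2_pos by auto
  then show ?thesis
    by (auto simp: c_tilde_def Let_def \<rho>_def rho_def intro!: Gamma_real_pos add_pos_pos divide_pos_pos less_imp_neq[THEN not_sym])
qed

lemma szego_at_1:
  "szego (2 * m) 1 = of_real (c_tilde WRefl \<rho> (k1, k2) / c_tilde WRefl (of_nat m + \<rho>) (k1, k2))"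
  "szego (2 * m + 1) 1 = of_real (c_tilde WRefl \<rho> (k1, k2) / c_tilde WId (of_nat (Suc m) + \<rho>) (k1, k2))"
proof -
  let ?c = "c_tilde WRefl \<rho> (k1, k2)"
  have odd_step: "szego (2 * m + 1) 1 = of_real (?c / c_tilde WId (of_nat (Suc m) + \<rho>) (k1, k2))"
    if "szego (2 * m) 1 = of_real (?c / c_tilde WRefl (of_nat m + \<rho>) (k1, k2))" for m
  proof -
    have "szego (2 * m + 1) 1
        = of_real (?c * ((1 - verblunsky (2 * m)) / c_tilde WRefl (of_nat m + \<rho>) (k1, k2)))"
      using that szego_at_1_Suc[of "2 * m"] by (simp del: szego.simps)
    then show ?thesis
      unfolding c_tilde_step_even by simp
  qed
  show even: "szego (2 * m) 1 = of_real (?c / c_tilde WRefl (of_nat m + \<rho>) (k1, k2))" for m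
  proof (induction m)
    case 0
    then show ?case using c_tilde_rho_neq_0 by simp
  next
    case (Suc m)
    have "szego (2 * Suc m) 1
        = of_real (?c * ((1 - verblunsky (2 * m + 1)) / c_tilde WId (of_nat (Suc m) + \<rho>) (k1, k2)))"
      using odd_step[OF Suc] szego_at_1_Suc[of "2 * m + 1"] by (simp del: szego.simps)
    then show ?case
      unfolding c_tilde_step_odd by simp
  qed
  show "szego (2 * m + 1) 1 = of_real (?c / c_tilde WId (of_nat (Suc m) + \<rho>) (k1, k2))" for m
    by (rule odd_step[OF even])
qed

end

theorem theorem5p9:
  fixes k1 k2 :: int
  assumes "even k1" and "k1 \<ge> 1" and "k2 \<ge> 1"
  shows "\<forall>n::int. nonsym_jacobi n (k1, k2) 1 =
    complex_of_real
      (c_tilde longest_weyl (rho (k1, k2)) (k1, k2) /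
       c_tilde (w_upper n * w_lower (weight_star n))
         (of_int (weight_star n) + rho (k1, k2)) (k1, k2))"
proof
  fix n :: int
  interpret jacobi_multiplicity k1 k2
    using assms by unfold_locales auto
  have val: "nonsym_jacobi n (k1, k2) 1 = szego (basis_position n) 1"
    by (simp add: nonsym_jacobi_def gram_schmidt_eq_szego)
  show "nonsym_jacobi n (k1, k2) 1 =
    complex_of_real
      (c_tilde longest_weyl (rho (k1, k2)) (k1, k2) /
       c_tilde (w_upper n * w_lower (weight_star n))
         (of_int (weight_star n) + rho (k1, k2)) (k1, k2))"
  proof (cases "n > 0")
    case True
    then obtain m where m: "n = int (Suc m)"
      using gr0_implies_Suc zero_less_imp_eq_int by blast
    then have "basis_position n = 2 * m + 1" by (simp add: basis_position_def nat_add_distrib nat_mult_distrib)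
    moreover have "w_upper n * w_lower (weight_star n) = WId"
      using True by (simp add: w_upper_def w_lower_def weight_star_def one_weyl_def times_weyl_def)
    moreover have "real_of_int (weight_star n) = of_nat (Suc m)"
      using m by (simp add: weight_star_def)
    ultimately show ?thesis
      unfolding val using szego_at_1(2)[of m] by (simp only: \<rho>_def)
  next
    case False
    then obtain m where m: "n = - int m"
      by (metis int_cases2 of_nat_0_less_iff of_nat_0 neq0_conv minus_zero)
    then have "basis_position n = 2 * m" by (simp add: basis_position_def nat_mult_distrib)
    moreover have "w_upper n * w_lower (weight_star n) = WRefl"
      using False by (simp add: w_upper_def w_lower_def weight_star_def one_weyl_def times_weyl_def)
    moreover have "real_of_int (weight_star n) = of_nat m"
      using m by (simp add: weight_star_def)
    ultimately show ?thesis
      unfolding val using szego_at_1(1)[of m] by (simp only: \<rho>_def)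
  qed
qed

end
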